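(* Let $\{A_t:\ t\in T_1\cup T_2\}$ be a family of nonempty subsets of $X$ (or of $X^*$), where $T_1,T_2$ are disjoint nonempty index sets. Then for every $m>0$, \[ \Big[\overline{\operatorname{co}}\Big(\bigcup_{t\in T_1\cup T_2}A_t\Big)\Big]_\infty=\Big[\overline{\operatorname{co}}\Big(\Big(\bigcup_{t\in T_1}A_t\Big)\cup\Big(\bigcup_{t\in T_2}mA_t\Big)\Big)\Big]_\infty=\Big[\overline{\operatorname{co}}\Big(\bigcup_{t_1\in T_1,\,t_2\in T_2}(A_{t_1}+mA_{t_2})\Big)\Big]_\infty . \]
   Context: $X$ is a real separated locally convex space with dual $X^*$ carrying the weak$^*$ topology (closures in $X^*$ are weak$^*$-closures). $\overline{\operatorname{co}}$ denotes the closed convex hull, $+$ the Minkowski sum, and $mA=\{ma: a\in A\}$. For a nonempty closed convex set $C$, its recession cone is $C_\infty:=\{y:\ z+\lambda y\in C\text{ for some } z\in C \text{ and all }\lambda\ge 0\}$. *)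

theory Defs
  imports "HOL-Analysis.Analysis"
begin

text \<open>A separated (Hausdorff) locally convex vector topology on a real vector space.
  This covers both X and X* with its weak-star topology.\<close>
definition sep_lc_topology :: "'a::real_vector topology \<Rightarrow> bool" where
  "sep_lc_topology U \<longleftrightarrow>
     topspace U = UNIV \<and> Hausdorff_space U \<and>
     continuous_map (prod_topology U U) U (\<lambda>(x, y). x + y) \<and>
     continuous_map (prod_topology euclideanreal U) U (\<lambda>(c, x). c *\<^sub>R x) \<and>
     (\<forall>x W. openin U W \<and> x \<in> W \<longrightarrow>
        (\<exists>V. openin U V \<and> convex V \<and> x \<in> V \<and> V \<subseteq> W))"

text \<open>Closed convex hull w.r.t. the topology U: smallest closed convex superset.\<close>
definition closed_convex_hull :: "'a::real_vector topology \<Rightarrow> 'a set \<Rightarrow> 'a set" where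
  "closed_convex_hull U S = \<Inter>{C. closedin U C \<and> convex C \<and> S \<subseteq> C}"

text \<open>Recession cone C_infinity.\<close>
definition recession_cone :: "'a::real_vector set \<Rightarrow> 'a set" where
  "recession_cone C = {y. \<exists>z\<in>C. \<forall>l\<ge>0. z + l *\<^sub>R y \<in> C}"

end

theory Submission
  imports Defs
begin

text \<open>Each of the three generating sets lies, after a positive rescaling, in the convex hull
  of another one up to a bounded error from a fixed segment: for instance
  \<open>(1/2)(a + m b)\<close> lies in the convex hull of \<open>A \<union> mB\<close>, and \<open>x + m b\<^sub>0\<close>, \<open>a\<^sub>0 + m b\<close> lie in
  \<open>A + mB\<close>. Such a bounded perturbation cannot change the recession cone of the closed convex
  hull: if \<open>z + \<lambda> y\<close> stays in the closure for all \<open>\<lambda> \<ge> 0\<close>, then for a base point \<open>a\<^sub>0\<close> of the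
  other hull the points \<open>(1 - t) a\<^sub>0 + t (r x + u)\<close>, with \<open>x\<close> close to \<open>z + (\<lambda>/(t r)) y\<close>,
  approach \<open>a\<^sub>0 + \<lambda> y\<close> as \<open>t \<rightarrow> 0\<close>, because the perturbation \<open>u\<close> gets multiplied by \<open>t\<close>.\<close>

lemma convex_average3:
  assumes "convex V" "a \<in> V" "b \<in> V" "c \<in> V"
  shows "(1/3) *\<^sub>R (a + b + c) \<in> V"
proof -
  have "(1/2) *\<^sub>R b + (1/2) *\<^sub>R c \<in> V"
    using assms by (intro convexD) auto
  then have "(1/3) *\<^sub>R a + (2/3) *\<^sub>R ((1/2) *\<^sub>R b + (1/2) *\<^sub>R c) \<in> V"
    using assms by (intro convexD) auto
  then show ?thesis
    by (simp add: scaleR_add_right add.assoc)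
qed

lemma scaleR_closed_segment_in_convex:
  assumes "convex V" "c *\<^sub>R d \<in> V" "c *\<^sub>R d' \<in> V" "u \<in> closed_segment d d'"
  shows "c *\<^sub>R u \<in> V"
proof -
  obtain s where "0 \<le> s" "s \<le> 1" "u = (1 - s) *\<^sub>R d + s *\<^sub>R d'"
    using assms(4) by (auto simp: in_segment)
  moreover have "(1 - s) *\<^sub>R (c *\<^sub>R d) + s *\<^sub>R (c *\<^sub>R d') \<in> V"
    using assms(1-3) calculation(1,2) by (intro convexD) auto
  ultimately show ?thesis
    by (simp add: scaleR_add_right mult.commute)
qed

lemma convex_hull_scaleR_within_segment:
  assumes "\<forall>x\<in>S. \<exists>u\<in>closed_segment d d'. r *\<^sub>R x + u \<in> convex hull S'"
    and "x \<in> convex hull S"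
  shows "\<exists>u\<in>closed_segment d d'. r *\<^sub>R x + u \<in> convex hull S'"
proof -
  define D where "D = (\<Union>s\<in>convex hull S'. \<Union>u\<in>closed_segment d d'. {s - u})"
  have "S \<subseteq> (*\<^sub>R) r -` D"
    using assms(1) by (force simp: D_def eq_diff_eq)
  moreover have "convex ((*\<^sub>R) r -` D)"
    unfolding D_def by (intro convex_linear_vimage linear_scaleR convex_differences) auto
  ultimately have "convex hull S \<subseteq> (*\<^sub>R) r -` D"
    by (rule hull_minimal)
  then show ?thesis
    using assms(2) by (force simp: D_def eq_diff_eq)
qed

lemma closed_convex_hull_empty [simp]: "closed_convex_hull U {} = {}"
  unfolding closed_convex_hull_def by (auto intro: closedin_empty)

locale lc_vector_topology =
  fixes U :: "'a::real_vector topology"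
  assumes sep_lc: "sep_lc_topology U"
begin

lemma topspace_eq [simp]: "topspace U = UNIV"
  using sep_lc by (simp add: sep_lc_topology_def)

lemma convex_open_subset:
  assumes "openin U W" "x \<in> W"
  obtains V where "openin U V" "convex V" "x \<in> V" "V \<subseteq> W"
  using sep_lc assms unfolding sep_lc_topology_def by blast

lemma continuous_map_add: "continuous_map (prod_topology U U) U (\<lambda>(x, y). x + y)"
  using sep_lc by (simp add: sep_lc_topology_def)

lemma continuous_map_scaleR:
  "continuous_map (prod_topology euclideanreal U) U (\<lambda>(c, x). c *\<^sub>R x)"
  using sep_lc by (simp add: sep_lc_topology_def)

lemma continuous_map_affine: "continuous_map U U (\<lambda>x. c *\<^sub>R x + v)"
proof -
  have "continuous_map U (prod_topology euclideanreal U) (\<lambda>x. (c, x))"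
    by (intro continuous_map_pairedI) auto
  from continuous_map_compose[OF this continuous_map_scaleR]
  have "continuous_map U U (\<lambda>x. c *\<^sub>R x)"
    by (simp add: o_def)
  then have "continuous_map U (prod_topology U U) (\<lambda>x. (c *\<^sub>R x, v))"
    by (intro continuous_map_pairedI) auto
  from continuous_map_compose[OF this continuous_map_add] show ?thesis
    by (simp add: o_def)
qed

lemma openin_affine_preimage:
  "openin U V \<Longrightarrow> openin U {x. c *\<^sub>R x + v \<in> V}"
  using openin_continuous_map_preimage[OF continuous_map_affine] by fastforce

lemma openin_scaleR_preimage: "openin U V \<Longrightarrow> openin U {x. c *\<^sub>R x \<in> V}"
  using openin_affine_preimage[of V c 0] by simp

lemma openin_translation_preimage: "openin U V \<Longrightarrow> openin U {x. x + v \<in> V}"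
  using openin_affine_preimage[of V 1 v] by simp

lemma eventually_scaleR_in_zero_nhd:
  assumes "openin U V" "0 \<in> V"
  shows "\<forall>\<^sub>F t in at_right 0. t *\<^sub>R v \<in> V"
proof -
  have "continuous_map euclideanreal (prod_topology euclideanreal U) (\<lambda>t. (t, v))"
    by (intro continuous_map_pairedI) auto
  from continuous_map_compose[OF this continuous_map_scaleR]
  have "continuous_map euclideanreal U (\<lambda>t. t *\<^sub>R v)"
    by (simp add: o_def)
  then have "open {t. t *\<^sub>R v \<in> V}"
    using openin_continuous_map_preimage[of euclideanreal U _ V] assms(1) by simp
  then have "\<forall>\<^sub>F t in nhds 0. t *\<^sub>R v \<in> V"
    using eventually_nhds_in_open[of _ 0] assms(2) by fastforce
  then show ?thesis
    unfolding eventually_at_filter by (rule eventually_mono) simp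
qed

lemma in_closure_of_iff_zero_nhds:
  "p \<in> U closure_of C \<longleftrightarrow> (\<forall>V. openin U V \<longrightarrow> 0 \<in> V \<longrightarrow> (\<exists>q\<in>C. q - p \<in> V))"
proof (intro iffI allI impI)
  fix V assume p: "p \<in> U closure_of C" and V: "openin U V" "0 \<in> V"
  define N where "N = {x. x + - p \<in> V}"
  have "openin U N"
    unfolding N_def using V(1) by (rule openin_translation_preimage)
  moreover have "p \<in> N"
    unfolding N_def using V(2) by simp
  ultimately obtain q where "q \<in> C" "q \<in> N"
    using p unfolding in_closure_of by meson
  then show "\<exists>q\<in>C. q - p \<in> V"
    unfolding N_def by auto
next
  assume zero_nhds: "\<forall>V. openin U V \<longrightarrow> 0 \<in> V \<longrightarrow> (\<exists>q\<in>C. q - p \<in> V)"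
  show "p \<in> U closure_of C"
    unfolding in_closure_of
  proof (intro conjI allI impI)
    fix W assume W: "p \<in> W \<and> openin U W"
    define N where "N = {w. w + p \<in> W}"
    have "openin U N" "0 \<in> N"
      unfolding N_def using W openin_translation_preimage by simp_all
    then obtain q where "q \<in> C" "q - p \<in> N"
      using zero_nhds by blast
    then show "\<exists>q. q \<in> C \<and> q \<in> W"
      unfolding N_def by auto
  qed simp
qed

lemma in_closure_of_if_convex_zero_nhds:
  assumes "\<forall>V. openin U V \<longrightarrow> convex V \<longrightarrow> 0 \<in> V \<longrightarrow> (\<exists>q\<in>C. q - p \<in> V)"
  shows "p \<in> U closure_of C"
  unfolding in_closure_of_iff_zero_nhds
proof (intro allI impI)
  fix V assume "openin U V" "0 \<in> V"
  then obtain V' where "openin U V'" "convex V'" "0 \<in> V'" "V' \<subseteq> V"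
    by (rule convex_open_subset)
  with assms show "\<exists>q\<in>C. q - p \<in> V" by blast
qed

lemma convex_closure_of:
  assumes "convex K"
  shows "convex (U closure_of K)"
proof (rule convexI)
  fix x y :: 'a and u v :: real
  assume x: "x \<in> U closure_of K" and y: "y \<in> U closure_of K"
    and uv: "0 \<le> u" "0 \<le> v" "u + v = 1"
  show "u *\<^sub>R x + v *\<^sub>R y \<in> U closure_of K"
  proof (rule in_closure_of_if_convex_zero_nhds, intro allI impI)
    fix V assume V: "openin U V" "convex V" "0 \<in> V"
    obtain a where a: "a \<in> K" "a - x \<in> V"
      using x V by (auto simp: in_closure_of_iff_zero_nhds)
    obtain b where b: "b \<in> K" "b - y \<in> V"
      using y V by (auto simp: in_closure_of_iff_zero_nhds)
    have "u *\<^sub>R (a - x) + v *\<^sub>R (b - y) \<in> V"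
      using V(2) a(2) b(2) uv by (rule convexD)
    moreover have "u *\<^sub>R a + v *\<^sub>R b \<in> K"
      using assms a(1) b(1) uv by (rule convexD)
    ultimately show "\<exists>q\<in>K. q - (u *\<^sub>R x + v *\<^sub>R y) \<in> V"
      by (intro bexI[of _ "u *\<^sub>R a + v *\<^sub>R b"]) (simp_all add: algebra_simps)
  qed
qed

lemma closed_convex_hull_eq_closure_of:
  "closed_convex_hull U S = U closure_of (convex hull S)"
proof (rule antisym)
  show "closed_convex_hull U S \<subseteq> U closure_of (convex hull S)"
    unfolding closed_convex_hull_def
    by (intro Inter_lower CollectI conjI closedin_closure_of convex_closure_of convex_convex_hull)
      (use closure_of_subset[of "convex hull S" U] hull_subset[of S convex] in auto)
  have "UNIV \<in> {C. closedin U C \<and> convex C \<and> S \<subseteq> C}"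
    using closedin_topspace[of U] by simp
  then have "closedin U (closed_convex_hull U S)" "convex (closed_convex_hull U S)"
    unfolding closed_convex_hull_def by (auto intro!: closedin_Inter convex_Inter)
  moreover have "convex hull S \<subseteq> closed_convex_hull U S"
    using calculation(2) by (intro hull_minimal) (auto simp: closed_convex_hull_def)
  ultimately show "U closure_of (convex hull S) \<subseteq> closed_convex_hull U S"
    by (intro closure_of_minimal)
qed

lemma closure_of_convex_hull_ray_perturbed:
  assumes within: "\<forall>x\<in>S. \<exists>u\<in>closed_segment d d'. r *\<^sub>R x + u \<in> convex hull S'"
    and "r > 0" and a0: "a0 \<in> convex hull S'"
    and z: "\<And>l. l \<ge> 0 \<Longrightarrow> z + l *\<^sub>R y \<in> U closure_of (convex hull S)"
    and "l \<ge> 0"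
  shows "a0 + l *\<^sub>R y \<in> U closure_of (convex hull S')"
proof (rule in_closure_of_if_convex_zero_nhds, intro allI impI)
  fix V assume V: "openin U V" "convex V" "0 \<in> V"
  have "\<forall>\<^sub>F t in at_right 0. t \<in> {0<..<1} \<and> t *\<^sub>R (3 *\<^sub>R (r *\<^sub>R z - a0)) \<in> V
      \<and> t *\<^sub>R (3 *\<^sub>R d) \<in> V \<and> t *\<^sub>R (3 *\<^sub>R d') \<in> V"
    using V by (intro eventually_conj eventually_at_right_real eventually_scaleR_in_zero_nhd) auto
  then obtain t where t: "0 < t" "t < 1" "t *\<^sub>R (3 *\<^sub>R (r *\<^sub>R z - a0)) \<in> V"
    "(t * 3) *\<^sub>R d \<in> V" "(t * 3) *\<^sub>R d' \<in> V"
    using eventually_happens'[OF trivial_limit_at_right_real] by auto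
  define zt where "zt = z + (l / (t * r)) *\<^sub>R y"
  have "zt \<in> U closure_of (convex hull S)"
    unfolding zt_def using \<open>r > 0\<close> t(1) \<open>l \<ge> 0\<close> by (intro z) simp
  moreover have "openin U {w. (3 * t * r) *\<^sub>R w \<in> V}" "0 \<in> {w. (3 * t * r) *\<^sub>R w \<in> V}"
    using V by (simp_all add: openin_scaleR_preimage)
  ultimately obtain x where x: "x \<in> convex hull S" "(3 * t * r) *\<^sub>R (x - zt) \<in> V"
    unfolding in_closure_of_iff_zero_nhds by force
  then obtain u where u: "u \<in> closed_segment d d'" "r *\<^sub>R x + u \<in> convex hull S'"
    using convex_hull_scaleR_within_segment within by blast
  define q where "q = (1 - t) *\<^sub>R a0 + t *\<^sub>R (r *\<^sub>R x + u)"
  have "q \<in> convex hull S'"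
    unfolding q_def using a0 u(2) t by (intro convexD) auto
  have "(t * 3) *\<^sub>R u \<in> V"
    using V(2) t(4,5) u(1) by (rule scaleR_closed_segment_in_convex)
  from convex_average3[OF V(2) t(3) this x(2)]
  have "(1/3) *\<^sub>R (t *\<^sub>R (3 *\<^sub>R (r *\<^sub>R z - a0)) + (t * 3) *\<^sub>R u
      + (3 * t * r) *\<^sub>R (x - zt)) \<in> V" .
  moreover have "(1/3) *\<^sub>R (t *\<^sub>R (3 *\<^sub>R (r *\<^sub>R z - a0)) + (t * 3) *\<^sub>R u
      + (3 * t * r) *\<^sub>R (x - zt)) = q - (a0 + l *\<^sub>R y)"
    using \<open>r > 0\<close> t(1) by (simp add: q_def zt_def algebra_simps)
  ultimately show "\<exists>q\<in>convex hull S'. q - (a0 + l *\<^sub>R y) \<in> V"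
    using \<open>q \<in> convex hull S'\<close> by metis
qed

lemma recession_cone_closed_convex_hull_subset:
  assumes within: "\<forall>x\<in>S. \<exists>u\<in>closed_segment d d'. r *\<^sub>R x + u \<in> convex hull S'"
    and "r > 0"
  shows "recession_cone (closed_convex_hull U S) \<subseteq> recession_cone (closed_convex_hull U S')"
proof
  fix y assume "y \<in> recession_cone (closed_convex_hull U S)"
  then obtain z where z: "\<And>l. l \<ge> 0 \<Longrightarrow> z + l *\<^sub>R y \<in> U closure_of (convex hull S)"
    by (auto simp: recession_cone_def closed_convex_hull_eq_closure_of)
  then have "S \<noteq> {}"
    by fastforce
  then obtain a0 where "a0 \<in> convex hull S'"
    using within by blast
  then have "a0 + l *\<^sub>R y \<in> U closure_of (convex hull S')" if "l \<ge> 0" for l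
    using closure_of_convex_hull_ray_perturbed[OF assms _ z that] by blast
  moreover have "a0 \<in> U closure_of (convex hull S')"
    using calculation[of 0] by simp
  ultimately show "y \<in> recession_cone (closed_convex_hull U S')"
    by (auto simp: recession_cone_def closed_convex_hull_eq_closure_of)
qed

lemma recession_cone_closed_convex_hull_Un_scaleR_subset:
  assumes "a0 \<in> P" "m > 0"
  shows "recession_cone (closed_convex_hull U (P \<union> Q))
    \<subseteq> recession_cone (closed_convex_hull U (P \<union> (*\<^sub>R) m ` Q))"
proof (rule recession_cone_closed_convex_hull_subset[where r = "min 1 m" and d = 0 and d' = a0], intro ballI)
  define r where "r = min 1 m"  \<comment> \<open>both \<open>r\<close> and \<open>r / m\<close> are convex weights\<close>
  have hull: "c *\<^sub>R x + (1 - c) *\<^sub>R a0 \<in> convex hull (P \<union> (*\<^sub>R) m ` Q)"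
    if "x \<in> P \<union> (*\<^sub>R) m ` Q" "0 \<le> c" "c \<le> 1" for x c
    using that assms(1) by (intro convexD convex_convex_hull hull_inc) auto
  have seg: "c *\<^sub>R a0 \<in> closed_segment 0 a0" if "0 \<le> c" "c \<le> 1" for c
    using that by (auto simp: in_segment)
  fix x assume "x \<in> P \<union> Q"
  then show "\<exists>u\<in>closed_segment 0 a0. r *\<^sub>R x + u \<in> convex hull (P \<union> (*\<^sub>R) m ` Q)"
  proof
    assume "x \<in> P"
    then show ?thesis
      using hull[of x r] seg[of "1 - r"] \<open>m > 0\<close> by (auto simp: r_def)
  next
    assume "x \<in> Q"
    then have "(r / m) *\<^sub>R (m *\<^sub>R x) + (1 - r / m) *\<^sub>R a0 \<in> convex hull (P \<union> (*\<^sub>R) m ` Q)"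
      using \<open>m > 0\<close> by (intro hull) (auto simp: r_def min_def)
    moreover have "1 - r / m \<le> 1" "0 \<le> 1 - r / m"
      using \<open>m > 0\<close> by (auto simp: r_def min_def)
    ultimately show ?thesis
      using seg[of "1 - r / m"] \<open>m > 0\<close> by auto
  qed
qed (use assms in auto)

lemma recession_cone_closed_convex_hull_Un_scaleR:
  assumes "a0 \<in> P" "m > 0"
  shows "recession_cone (closed_convex_hull U (P \<union> Q))
    = recession_cone (closed_convex_hull U (P \<union> (*\<^sub>R) m ` Q))"
proof (rule antisym)
  show "recession_cone (closed_convex_hull U (P \<union> Q))
    \<subseteq> recession_cone (closed_convex_hull U (P \<union> (*\<^sub>R) m ` Q))"
    using assms by (rule recession_cone_closed_convex_hull_Un_scaleR_subset)
  have "P \<union> (*\<^sub>R) (1/m) ` (*\<^sub>R) m ` Q = P \<union> Q"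
    using \<open>m > 0\<close> by (simp add: image_image)
  then show "recession_cone (closed_convex_hull U (P \<union> (*\<^sub>R) m ` Q))
    \<subseteq> recession_cone (closed_convex_hull U (P \<union> Q))"
    using recession_cone_closed_convex_hull_Un_scaleR_subset[OF \<open>a0 \<in> P\<close>, of "1/m" "(*\<^sub>R) m ` Q"]
      \<open>m > 0\<close> by simp
qed

lemma recession_cone_closed_convex_hull_Un_eq_sums:
  assumes "a0 \<in> P" "b0 \<in> Q"
  shows "recession_cone (closed_convex_hull U (P \<union> Q))
    = recession_cone (closed_convex_hull U {a + b | a b. a \<in> P \<and> b \<in> Q})"
proof (rule antisym)
  show "recession_cone (closed_convex_hull U (P \<union> Q))
    \<subseteq> recession_cone (closed_convex_hull U {a + b | a b. a \<in> P \<and> b \<in> Q})"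
  proof (rule recession_cone_closed_convex_hull_subset[where r = 1 and d = b0 and d' = a0], intro ballI)
    fix x assume "x \<in> P \<union> Q"
    then have "x + b0 \<in> {a + b | a b. a \<in> P \<and> b \<in> Q} \<or> x + a0 \<in> {a + b | a b. a \<in> P \<and> b \<in> Q}"
      using assms by (auto intro: add.commute)
    moreover have "b0 \<in> closed_segment b0 a0" "a0 \<in> closed_segment b0 a0"
      by simp_all
    ultimately show "\<exists>u\<in>closed_segment b0 a0. 1 *\<^sub>R x + u \<in> convex hull {a + b | a b. a \<in> P \<and> b \<in> Q}"
      by (auto intro: hull_inc)
  qed simp
  show "recession_cone (closed_convex_hull U {a + b | a b. a \<in> P \<and> b \<in> Q})
    \<subseteq> recession_cone (closed_convex_hull U (P \<union> Q))"
  proof (rule recession_cone_closed_convex_hull_subset[where r = "1/2" and d = 0 and d' = 0], intro ballI)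
    fix x assume "x \<in> {a + b | a b. a \<in> P \<and> b \<in> Q}"
    then obtain a b where "a \<in> P" "b \<in> Q" "x = a + b" by blast
    then have "(1/2) *\<^sub>R a + (1/2) *\<^sub>R b \<in> convex hull (P \<union> Q)"
      by (intro convexD convex_convex_hull hull_inc) auto
    then show "\<exists>u\<in>closed_segment 0 0. (1/2) *\<^sub>R x + u \<in> convex hull (P \<union> Q)"
      using \<open>x = a + b\<close> by (simp add: scaleR_add_right)
  qed simp
qed

end

theorem lemma3:
  fixes U :: "'a::real_vector topology"
    and A :: "'i \<Rightarrow> 'a set" and T1 T2 :: "'i set" and m :: real
  assumes "sep_lc_topology U"
    and "T1 \<inter> T2 = {}" and "T1 \<noteq> {}" and "T2 \<noteq> {}"
    and "\<And>t. t \<in> T1 \<union> T2 \<Longrightarrow> A t \<noteq> {}"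
    and "m > 0"
  shows "(recession_cone (closed_convex_hull U (\<Union>t\<in>T1 \<union> T2. A t))
           = recession_cone (closed_convex_hull U
               ((\<Union>t\<in>T1. A t) \<union> (\<Union>t\<in>T2. (\<lambda>a. m *\<^sub>R a) ` A t))))
         \<and> ( recession_cone (closed_convex_hull U
               ((\<Union>t\<in>T1. A t) \<union> (\<Union>t\<in>T2. (\<lambda>a. m *\<^sub>R a) ` A t)))
           = recession_cone (closed_convex_hull U
               (\<Union>t1\<in>T1. \<Union>t2\<in>T2. {a + m *\<^sub>R b | a b. a \<in> A t1 \<and> b \<in> A t2})))"
proof -
  interpret lc_vector_topology U
    by unfold_locales (rule assms(1))
  define P where "P = (\<Union>t\<in>T1. A t)"
  define Q where "Q = (\<Union>t\<in>T2. A t)"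
  obtain t1 t2 where "t1 \<in> T1" "t2 \<in> T2"
    using assms(3,4) by blast
  moreover obtain a0 b0 where "a0 \<in> A t1" "b0 \<in> A t2"
    using assms(5) calculation by blast
  ultimately have "a0 \<in> P" "b0 \<in> Q"
    by (auto simp: P_def Q_def)
  have "(\<Union>t\<in>T1 \<union> T2. A t) = P \<union> Q"
    by (simp add: P_def Q_def)
  moreover have "(\<Union>t\<in>T1. A t) \<union> (\<Union>t\<in>T2. (\<lambda>a. m *\<^sub>R a) ` A t) = P \<union> (*\<^sub>R) m ` Q"
    by (auto simp: P_def Q_def)
  moreover have "(\<Union>t1\<in>T1. \<Union>t2\<in>T2. {a + m *\<^sub>R b | a b. a \<in> A t1 \<and> b \<in> A t2})
      = {a + b | a b. a \<in> P \<and> b \<in> (*\<^sub>R) m ` Q}"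
    by (auto simp: P_def Q_def)
  ultimately show ?thesis
    using recession_cone_closed_convex_hull_Un_scaleR[OF \<open>a0 \<in> P\<close> \<open>m > 0\<close>, of Q]
      recession_cone_closed_convex_hull_Un_eq_sums[OF \<open>a0 \<in> P\<close> imageI[OF \<open>b0 \<in> Q\<close>]]
    by simp
qed

end
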